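(* Let $0<q<1$. For all $x\in\mathbb{C}$, the limit relations $$\lim_{n\rightarrow\infty}q^{n(n-1)}\varphi_{2n}(x;q^{-1})=\mathcal{S}h_{q}(x)\quad\text{and}\quad \lim_{n\rightarrow\infty}q^{n^{2}}\varphi_{2n+1}(x;q^{-1})=\mathcal{C}h_{q}(x)$$ hold.
   Context: Here $0<q<1$ and fractional powers of $q$ are positive reals. $(a;q)_{n}=\prod_{k=0}^{n-1}(1-aq^{k})$. The $q^{-1}$-Fibonacci polynomials $\varphi_n(x;q^{-1})$, $n\in\{0,1,2,\dots\}$, are defined by $$\varphi_{n}(x;q^{-1})=\sum_{k\ge 0,\ 2k<n}\frac{(q;q)_{n-k-1}}{(q;q)_{k}(q;q)_{n-2k-1}}\,q^{k(k+1-n)}x^{n-2k-1};$$ equivalently $\varphi_0=0$, $\varphi_1=1$ and $\varphi_{n+1}(x;q^{-1})=x\varphi_{n}(x;q^{-1})+q^{-(n-1)}\varphi_{n-1}(x;q^{-1})$ for $n\ge1$. The $q$-sine and $q$-cosine are the entire functions $$\mathcal{S}_{q}(z)=\sum_{n=0}^{\infty}\frac{(-1)^{n}q^{n(n+1)}}{(q;q)_{2n+1}}z^{2n+1},\qquad \mathcal{C}_{q}(z)=\sum_{n=0}^{\infty}\frac{(-1)^{n}q^{n^{2}}}{(q;q)_{2n}}z^{2n},$$ and their hyperbolic versions are $\mathcal{S}h_{q}(z)=-\mathrm{i}\,\mathcal{S}_{q}(\mathrm{i}z)$ and $\mathcal{C}h_{q}(z)=\mathcal{C}_{q}(\mathrm{i}z)$.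 *)

theory Defs
  imports Complex_Main
begin

definition q_pochhammer :: "real \<Rightarrow> real \<Rightarrow> nat \<Rightarrow> real" where
  "q_pochhammer a q n = (\<Prod>k<n. 1 - a * q ^ k)"

text \<open>\<open>q_inv_fibonacci q n x\<close> is $\varphi_n(x;q^{-1})$: the parameter is \<open>q\<close>, not its inverse.
  The exponent $k(k+1-n)$ is a nonpositive integer, hence the integer power.\<close>

definition q_inv_fibonacci :: "real \<Rightarrow> nat \<Rightarrow> complex \<Rightarrow> complex" where
  "q_inv_fibonacci q n x =
     (\<Sum>k | 2 * k < n.
        complex_of_real
          (q_pochhammer q q (n - k - 1) / (q_pochhammer q q k * q_pochhammer q q (n - 2 * k - 1))
            * q powi (int k * (int k + 1 - int n)))
        * x ^ (n - 2 * k - 1))"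

definition q_sin :: "real \<Rightarrow> complex \<Rightarrow> complex" where
  "q_sin q z =
     (\<Sum>n. complex_of_real ((-1) ^ n * q ^ (n * (n + 1)) / q_pochhammer q q (2 * n + 1))
            * z ^ (2 * n + 1))"

definition q_cos :: "real \<Rightarrow> complex \<Rightarrow> complex" where
  "q_cos q z =
     (\<Sum>n. complex_of_real ((-1) ^ n * q ^ (n\<^sup>2) / q_pochhammer q q (2 * n)) * z ^ (2 * n))"

definition q_sinh :: "real \<Rightarrow> complex \<Rightarrow> complex" where
  "q_sinh q z = - \<i> * q_sin q (\<i> * z)"

definition q_cosh :: "real \<Rightarrow> complex \<Rightarrow> complex" where
  "q_cosh q z = q_cos q (\<i> * z)"

end

theory Submission
  imports Defs "HOL-Analysis.Uniform_Limit"
begin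

text \<open>
  Reversing the summation order is what makes the limit visible. Both parities are the case
  \<open>p \<in> {0, 1}\<close> of the index \<open>2 n + 1 - p\<close>: summing over \<open>j = n - p - k\<close>, the exponent of \<open>x\<close>
  becomes \<open>2 j + p\<close>, and since
  \[ k (k + 1 - (2 n + 1 - p)) = (n - p - j) (- n - j) = j (j + p) - n (n - p), \]
  the scaling factor $q^{n(n-p)}$ removes exactly the part of the power of \<open>q\<close> that depends on
  \<open>n\<close>. The scaled polynomial is therefore (\<open>scaled_q_inv_fibonacci\<close>)
  \[ \sum_{j=0}^{n-p} \frac{(q;q)_{n+j}}{(q;q)_{n-j-p}} \cdot
       \frac{q^{j(j+p)} x^{2j+p}}{(q;q)_{2j+p}}, \]
  whose second factors are the terms of the series of the hyperbolic \<open>q\<close>-sine (\<open>p = 1\<close>) and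
  \<open>q\<close>-cosine (\<open>p = 0\<close>), while \<open>n\<close> enters only through the first factor and the range.

  The first factor is a product of \<open>2 j + p\<close> numbers $1 - q^m$ with \<open>m > n - j - p\<close>. It lies in
  \<open>[0, 1]\<close> (\<open>q_pochhammer_ratio_bounds\<close>) and tends to 1 for fixed \<open>j\<close>
  (\<open>q_pochhammer_ratio_tendsto\<close>), so the absolutely convergent limit series
  (\<open>summable_norm_q_trig_term\<close>) dominates the sums and Tannery's theorem
  exchanges limit and summation.
\<close>

lemma q_pochhammer_pos:
  assumes "0 < q" "q < 1"
  shows "0 < q_pochhammer q q n"
  unfolding q_pochhammer_def
  using assms by (intro prod_pos) (simp flip: power_Suc add: power_Suc_less_one)

lemma q_pochhammer_Suc: "q_pochhammer a q (Suc n) = q_pochhammer a q n * (1 - a * q ^ n)"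
  by (simp add: q_pochhammer_def)

lemma q_pochhammer_add:
  "q_pochhammer a q (m + n) = q_pochhammer a q m * (\<Prod>i<n. 1 - a * q ^ (m + i))"
  by (induction n) (simp_all add: q_pochhammer_Suc mult.assoc)

text \<open>
  The \<open>j\<close>-th term of the power series of the hyperbolic \<open>q\<close>-cosine for \<open>p = 0\<close> and of the
  hyperbolic \<open>q\<close>-sine for \<open>p = 1\<close>.
\<close>

definition q_trig_term :: "nat \<Rightarrow> real \<Rightarrow> complex \<Rightarrow> nat \<Rightarrow> complex" where
  "q_trig_term p q x j =
     complex_of_real (q ^ (j * (j + p)) / q_pochhammer q q (2 * j + p)) * x ^ (2 * j + p)"

lemma q_trig_term_Suc:
  "q_trig_term p q x (Suc j) =
     complex_of_real (q ^ (2 * j + p + 1) / ((1 - q ^ (2 * j + p + 1)) * (1 - q ^ (2 * j + p + 2))))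
       * x\<^sup>2 * q_trig_term p q x j"
proof -
  have "Suc j * (Suc j + p) = j * (j + p) + (2 * j + p + 1)"
    by (simp add: algebra_simps)
  moreover have "q_pochhammer q q (2 * Suc j + p) =
      q_pochhammer q q (2 * j + p) * ((1 - q ^ (2 * j + p + 1)) * (1 - q ^ (2 * j + p + 2)))"
    by (simp add: q_pochhammer_Suc algebra_simps)
  moreover have "x ^ (2 * Suc j + p) = x\<^sup>2 * x ^ (2 * j + p)"
    by (simp add: power2_eq_square)
  moreover have "q ^ (j * (j + p) + (2 * j + p + 1)) = q ^ (j * (j + p)) * q ^ (2 * j + p + 1)"
    by (rule power_add)
  moreover have "complex_of_real (a * b / (c * d)) * (x\<^sup>2 * y) =
      complex_of_real (b / d) * x\<^sup>2 * (complex_of_real (a / c) * y)" for a b c d y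
    by (simp add: mult_ac)
  ultimately show ?thesis
    unfolding q_trig_term_def by (simp only:)
qed

text \<open>
  The ratio by which the terms grow carries the factor $q^{2j+p+1}$, so it tends to 0, and the
  series converges absolutely for every \<open>x\<close>.
\<close>

lemma summable_norm_q_trig_term:
  assumes "0 < q" "q < 1"
  shows "summable (\<lambda>j. norm (q_trig_term p q x j))"
proof -
  define r where
    "r j = q ^ (2 * j + p + 1) / ((1 - q ^ (2 * j + p + 1)) * (1 - q ^ (2 * j + p + 2))) * (norm x)\<^sup>2"
    for j
  have pow: "(\<lambda>j. q ^ (2 * j + p + c)) \<longlonglongrightarrow> 0" for c
  proof -
    have "strict_mono (\<lambda>j. 2 * j + p + c)"
      by (simp add: strict_mono_def)
    from LIMSEQ_subseq_LIMSEQ[OF LIMSEQ_power_zero this, of q] show ?thesis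
      using assms by (simp add: o_def)
  qed
  have "r \<longlonglongrightarrow> 0 / ((1 - 0) * (1 - 0)) * (norm x)\<^sup>2"
    unfolding r_def by (intro tendsto_intros pow) simp
  then have "eventually (\<lambda>j. r j < 1 / 2) sequentially"
    by (rule order_tendstoD(2)) simp
  then obtain N where N: "\<And>j. j \<ge> N \<Longrightarrow> r j < 1 / 2"
    by (auto simp: eventually_sequentially)
  have step: "norm (q_trig_term p q x (Suc j)) = r j * norm (q_trig_term p q x j)" for j
  proof -
    have "q ^ (2 * j + p + 1) < 1" "q ^ (2 * j + p + 2) < 1"
      using assms by (simp_all only: power_less_one_iff) simp_all
    then have "0 \<le> q ^ (2 * j + p + 1) / ((1 - q ^ (2 * j + p + 1)) * (1 - q ^ (2 * j + p + 2)))"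
      using assms by (intro divide_nonneg_nonneg mult_nonneg_nonneg) auto
    then show ?thesis
      unfolding q_trig_term_Suc r_def by (simp only: norm_mult norm_of_real norm_power abs_of_nonneg)
  qed
  show ?thesis
  proof (rule summable_ratio_test[of "1 / 2" N])
    fix j assume "N \<le> j"
    then have "r j * norm (q_trig_term p q x j) \<le> 1 / 2 * norm (q_trig_term p q x j)"
      using N by (intro mult_right_mono) (auto simp: less_imp_le)
    then show "norm (norm (q_trig_term p q x (Suc j))) \<le> 1 / 2 * norm (norm (q_trig_term p q x j))"
      unfolding step[symmetric] by simp
  qed simp
qed

lemma q_pochhammer_ratio:
  assumes "0 < q" "q < 1" "j + p \<le> n"
  shows "q_pochhammer q q (n + j) / q_pochhammer q q (n - (j + p)) =
         (\<Prod>i<2 * j + p. 1 - q * q ^ (n - (j + p) + i))"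
proof -
  have "n + j = (n - (j + p)) + (2 * j + p)"
    using assms by simp
  then have "q_pochhammer q q (n + j) = q_pochhammer q q (n - (j + p)) *
         (\<Prod>i<2 * j + p. 1 - q * q ^ (n - (j + p) + i))"
    by (metis q_pochhammer_add)
  then show ?thesis
    using q_pochhammer_pos[OF assms(1,2), of "n - (j + p)"] by simp
qed

lemma q_pochhammer_ratio_bounds:
  assumes "0 < q" "q < 1" "j + p \<le> n"
  shows "q_pochhammer q q (n + j) / q_pochhammer q q (n - (j + p)) \<in> {0..1}"
  unfolding q_pochhammer_ratio[OF assms] atLeastAtMost_iff
  using assms
  by (intro conjI prod_nonneg prod_le_1) (simp_all flip: power_Suc add: power_le_one)

text \<open>
  The number of factors of the quotient does not grow with \<open>n\<close>, so its limit is the product of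
  the limits of the factors.
\<close>

lemma q_pochhammer_ratio_tendsto:
  assumes "0 < q" "q < 1"
  shows "(\<lambda>n. q_pochhammer q q (n + j) / q_pochhammer q q (n - (j + p))) \<longlonglongrightarrow> 1"
proof (rule Lim_transform_eventually)
  have "(\<lambda>n. q ^ (n - (j + p) + i)) \<longlonglongrightarrow> 0" for i
    by (rule LIMSEQ_offset[where k = "j + p"])
      (use assms in \<open>simp add: power_add tendsto_mult_left_zero LIMSEQ_power_zero\<close>)
  then have "(\<lambda>n. \<Prod>i<2 * j + p. 1 - q * q ^ (n - (j + p) + i)) \<longlonglongrightarrow> (\<Prod>i<2 * j + p. 1 - q * 0)"
    by (intro tendsto_intros)
  then show "(\<lambda>n. \<Prod>i<2 * j + p. 1 - q * q ^ (n - (j + p) + i)) \<longlonglongrightarrow> 1"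
    by simp
  show "\<forall>\<^sub>F n in sequentially. (\<Prod>i<2 * j + p. 1 - q * q ^ (n - (j + p) + i)) =
          q_pochhammer q q (n + j) / q_pochhammer q q (n - (j + p))"
    using eventually_ge_at_top[of "j + p"]
    by eventually_elim (simp add: q_pochhammer_ratio assms)
qed

text \<open>
  The substitution \<open>j = n - p - k\<close> is an involution. It matches the range \<open>2 k < 2 n + 1 - p\<close>
  with \<open>j + p \<le> n\<close> because \<open>p \<le> 1\<close>: for larger \<open>p\<close> the defining sum would also contain terms
  with negative \<open>j\<close>.
\<close>

lemma scaled_q_inv_fibonacci:
  assumes "0 < q" "q < 1" "p \<le> 1"
  shows "complex_of_real (q ^ (n * (n - p))) * q_inv_fibonacci q (2 * n + 1 - p) x =
    (\<Sum>j | j + p \<le> n.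
       complex_of_real (q_pochhammer q q (n + j) / q_pochhammer q q (n - (j + p)))
         * q_trig_term p q x j)"
  unfolding q_inv_fibonacci_def sum_distrib_left
proof (rule sum.reindex_bij_witness[where i = "\<lambda>j. n - (j + p)" and j = "\<lambda>k. n - (k + p)"])
  fix k assume "k \<in> {k. 2 * k < 2 * n + 1 - p}"
  then have k: "k + p \<le> n"
    using assms(3) by auto
  define j where "j = n - (k + p)"
  have n: "n = j + k + p"
    using k by (simp add: j_def)
  have exps: "2 * n + 1 - p - k - 1 = n + j" "2 * n + 1 - p - 2 * k - 1 = 2 * j + p"
      "n - (j + p) = k"
    by (simp_all add: n)
  have "int (n * (n - p)) + int k * (int k + 1 - int (2 * n + 1 - p)) = int (j * (j + p))"
    by (simp add: n algebra_simps)
  then have pow: "q ^ (n * (n - p)) * q powi (int k * (int k + 1 - int (2 * n + 1 - p))) =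
      q ^ (j * (j + p))"
    using assms(1) by (metis less_irrefl power_int_add power_int_of_nat)
  have "complex_of_real (q ^ (n * (n - p))) * (complex_of_real
      (q_pochhammer q q (n + j) / (q_pochhammer q q k * q_pochhammer q q (2 * j + p))
         * q powi (int k * (int k + 1 - int (2 * n + 1 - p)))) * x ^ (2 * j + p)) =
      complex_of_real (q_pochhammer q q (n + j) / q_pochhammer q q k) * q_trig_term p q x j"
    unfolding q_trig_term_def pow[symmetric]
    by simp
  then show "complex_of_real (q_pochhammer q q (n + (n - (k + p))) /
        q_pochhammer q q (n - (n - (k + p) + p))) * q_trig_term p q x (n - (k + p)) =
      complex_of_real (q ^ (n * (n - p))) * (complex_of_real
        (q_pochhammer q q (2 * n + 1 - p - k - 1) /
          (q_pochhammer q q k * q_pochhammer q q (2 * n + 1 - p - 2 * k - 1))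
         * q powi (int k * (int k + 1 - int (2 * n + 1 - p)))) * x ^ (2 * n + 1 - p - 2 * k - 1))"
    unfolding j_def[symmetric] exps by simp
qed (use assms(3) in auto)

text \<open>
  Tannery's theorem speaks of infinite series, so the finite sums are extended by zero terms.
\<close>

lemma scaled_q_inv_fibonacci_tendsto:
  assumes "0 < q" "q < 1" "p \<le> 1"
  shows "(\<lambda>n. complex_of_real (q ^ (n * (n - p))) * q_inv_fibonacci q (2 * n + 1 - p) x)
           \<longlonglongrightarrow> (\<Sum>j. q_trig_term p q x j)"
proof -
  let ?a = "\<lambda>j n. if j + p \<le> n
    then complex_of_real (q_pochhammer q q (n + j) / q_pochhammer q q (n - (j + p)))
      * q_trig_term p q x j
    else 0"
  have limit: "(\<lambda>n. ?a j n) \<longlonglongrightarrow> q_trig_term p q x j" for j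
  proof (rule Lim_transform_eventually)
    show "(\<lambda>n. complex_of_real (q_pochhammer q q (n + j) / q_pochhammer q q (n - (j + p)))
        * q_trig_term p q x j) \<longlonglongrightarrow> q_trig_term p q x j"
      using tendsto_mult_right[OF tendsto_of_real[OF q_pochhammer_ratio_tendsto[OF assms(1,2)]],
          of j p "q_trig_term p q x j"]
      by simp
    show "\<forall>\<^sub>F n in sequentially.
        complex_of_real (q_pochhammer q q (n + j) / q_pochhammer q q (n - (j + p)))
          * q_trig_term p q x j = ?a j n"
      using eventually_ge_at_top[of "j + p"] by eventually_elim simp
  qed
  have bound: "norm (?a j n) \<le> norm (q_trig_term p q x j)" for j n
  proof (cases "j + p \<le> n")
    case True
    have "norm (complex_of_real (q_pochhammer q q (n + j) / q_pochhammer q q (n - (j + p)))) \<le> 1"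
      using q_pochhammer_ratio_bounds[OF assms(1,2) True] unfolding norm_of_real by auto
    from mult_right_mono[OF this norm_ge_zero[of "q_trig_term p q x j"]] True show ?thesis
      by (simp only: norm_mult if_True mult_1_left)
  qed simp
  have "\<forall>\<^sub>F (j, n) in sequentially \<times>\<^sub>F sequentially.
      norm (?a j n) \<le> norm (q_trig_term p q x j)"
    using bound by (intro always_eventually) (simp only: split_paired_All case_prod_conv, blast)
  from tannerys_theorem[OF limit this summable_norm_q_trig_term[OF assms(1,2)]]
  have "(\<lambda>n. \<Sum>j. ?a j n) \<longlonglongrightarrow> (\<Sum>j. q_trig_term p q x j)"
    by simp
  moreover have "(\<Sum>j. ?a j n) =
      complex_of_real (q ^ (n * (n - p))) * q_inv_fibonacci q (2 * n + 1 - p) x" for n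
  proof -
    have "finite {j. j + p \<le> n}"
      by (rule finite_subset[of _ "{..n}"]) auto
    then have "(\<Sum>j. ?a j n) = (\<Sum>j | j + p \<le> n. ?a j n)"
      by (intro suminf_finite) auto
    then show ?thesis
      unfolding scaled_q_inv_fibonacci[OF assms] by simp
  qed
  ultimately show ?thesis
    by (simp only:)
qed

text \<open>
  At \<open>\<i> x\<close> the alternating sign of the trigonometric series cancels against
  $\mathrm{i}^{2j} = (-1)^j$; only the constant $\mathrm{i}^p$ is left.
\<close>

lemma q_trig_term_rotate:
  "complex_of_real ((-1) ^ j * q ^ (j * (j + p)) / q_pochhammer q q (2 * j + p))
     * (\<i> * x) ^ (2 * j + p) = \<i> ^ p * q_trig_term p q x j"
proof -
  have "\<i> ^ (2 * j) = (-1) ^ j"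
    by (simp add: power_mult)
  then have "(\<i> * x) ^ (2 * j + p) = (-1) ^ j * (\<i> ^ p * x ^ (2 * j + p))"
    by (simp only: power_mult_distrib power_add mult_ac)
  moreover have "complex_of_real ((-1) ^ j * q ^ (j * (j + p)) / q_pochhammer q q (2 * j + p)) =
      (-1) ^ j * complex_of_real (q ^ (j * (j + p)) / q_pochhammer q q (2 * j + p))"
    by simp
  moreover have "((-1) ^ j * c) * ((-1) ^ j * (\<i> ^ p * d)) = \<i> ^ p * (c * d)" for c d :: complex
  proof -
    have "((-1) ^ j * c) * ((-1) ^ j * (\<i> ^ p * d)) = ((-1) ^ j * (-1) ^ j) * (\<i> ^ p * (c * d))"
      by (simp only: mult_ac)
    then show ?thesis
      by (simp flip: power_mult_distrib)
  qed
  ultimately show ?thesis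
    unfolding q_trig_term_def by (simp only:)
qed

lemma q_sinh_eq_suminf:
  assumes "0 < q" "q < 1"
  shows "q_sinh q x = (\<Sum>j. q_trig_term 1 q x j)"
  unfolding q_sinh_def q_sin_def
  using q_trig_term_rotate[of _ q 1 x]
    suminf_mult[OF summable_norm_cancel[OF summable_norm_q_trig_term[OF assms]], of \<i> 1 x]
  by simp

lemma q_cosh_eq_suminf: "q_cosh q x = (\<Sum>j. q_trig_term 0 q x j)"
  unfolding q_cosh_def q_cos_def
  using q_trig_term_rotate[of _ q 0 x] by (simp add: power2_eq_square)

theorem proposition6:
  fixes q :: real and x :: complex
  assumes "0 < q" and "q < 1"
  shows "(\<lambda>n. complex_of_real (q ^ (n * (n - 1))) * q_inv_fibonacci q (2 * n) x)
           \<longlonglongrightarrow> q_sinh q x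
       \<and> (\<lambda>n. complex_of_real (q ^ (n\<^sup>2)) * q_inv_fibonacci q (2 * n + 1) x)
           \<longlonglongrightarrow> q_cosh q x"
  using scaled_q_inv_fibonacci_tendsto[OF assms, of 1 x]
    scaled_q_inv_fibonacci_tendsto[OF assms, of 0 x]
  by (simp add: q_sinh_eq_suminf[OF assms] q_cosh_eq_suminf power2_eq_square)

end
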